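(* Let $k$ be a positive integer, let $\sigma \geq \frac{1}{\sqrt{2}}$ and $\delta = 2+\sigma+\frac{1}{2\sigma}$. Let $G$ be a $\sigma$-separable ²graph with $g = \bar{v}(G)-1 \geq \sigma+\frac{1}{2\sigma}$. Then $\bar{e}(G) \leq \delta g < \delta \bar{v}(G)$. Consequently, every finite simple graph with average degree at least $\delta k-1$ has a $(k+1)$-connected subgraph on more than $(1+\sigma)k$ vertices.
   Context: Fix a positive integer $k$. A ²graph is a pair $G=(V(G),E(G))$ with $V(G)$ a finite set and $E(G)\subseteq V(G)\times V(G)$ (ordered pairs, loops $(v,v)$ allowed). Write $v(G)=|V(G)|$, $e(G)=|E(G)|$, and normalize $\bar{v}(G)=v(G)/k$, $\bar{e}(G)=e(G)/k^2$. A sub²graph $C$ of $G$ is a ²graph with $V(C)\subseteq V(G)$ and $E(C)\subseteq E(G)$; it is spanning if $V(C)=V(G)$ and induced if $E(C)=E(G)\cap (V(C)\times V(C))$. A separation of a ²graph $G$ is a pair $(A,B)$ of induced, non-spanning sub²graphs of $G$ with $V(A)\cup V(B)=V(G)$, $E(A)\cup E(B)=E(G)$ and $|V(A)\cap V(B)|=k$. A ²graph $G$ is $\sigma$-separable if every sub²graph $C$ of $G$ with $\bar{v}(C)>1+\sigma$ has a separation. A graph is $(k+1)$-connected if it has more than $k+1$ vertices and remains connected after deleting any set of at most $k$ vertices; average degree of a graph $H$ means $2|E(H)|/|V(H)|$. *)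

theory Defs
  imports Complex_Main "Graph_Theory.Graph_Theory"
begin

(* Directed graphs with loops but without parallel arcs, i.e. pairs of a finite set V
   and a set E of ordered pairs over V, are the pair_fin_digraph structures of
   Graph_Theory. Between such graphs, "subgraph", "spanning" and "induced_subgraph"
   apply through the declared coercion with_proj. *)

definition vbar :: "nat \<Rightarrow> 'a pair_pre_digraph \<Rightarrow> real" where
  "vbar k G = real (card (pverts G)) / real k"

definition ebar :: "nat \<Rightarrow> 'a pair_pre_digraph \<Rightarrow> real" where
  "ebar k G = real (card (parcs G)) / (real k)\<^sup>2"

definition separation ::
  "nat \<Rightarrow> 'a pair_pre_digraph \<Rightarrow> 'a pair_pre_digraph \<Rightarrow> 'a pair_pre_digraph \<Rightarrow> bool" where
  "separation k G A B \<longleftrightarrow>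
     induced_subgraph (with_proj A) (with_proj G) \<and> \<not> spanning (with_proj A) (with_proj G) \<and>
     induced_subgraph (with_proj B) (with_proj G) \<and> \<not> spanning (with_proj B) (with_proj G) \<and>
     pverts A \<union> pverts B = pverts G \<and> parcs A \<union> parcs B = parcs G \<and>
     card (pverts A \<inter> pverts B) = k"

definition separable :: "nat \<Rightarrow> real \<Rightarrow> 'a pair_pre_digraph \<Rightarrow> bool" where
  "separable k \<sigma> G \<longleftrightarrow>
     (\<forall>C :: 'a pair_pre_digraph. subgraph (with_proj C) (with_proj G) \<and> vbar k C > 1 + \<sigma> \<longrightarrow>
        (\<exists>A B. separation k C A B))"

(* Finite simple graphs are the pair_graph structures (symmetric, loop-free): an edge uv
   is represented by the two arcs (u,v) and (v,u), so edges are counted as unordered pairs. *)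

definition undirected_edges :: "'a pair_pre_digraph \<Rightarrow> 'a set set" where
  "undirected_edges H = (\<lambda>(u, v). {u, v}) ` parcs H"

definition average_degree :: "'a pair_pre_digraph \<Rightarrow> real" where
  "average_degree H = 2 * real (card (undirected_edges H)) / real (card (pverts H))"

(* For l = k + 1, "card S < l" says that at most k vertices are deleted. *)

definition l_connected :: "nat \<Rightarrow> 'a pair_pre_digraph \<Rightarrow> bool" where
  "l_connected l K \<longleftrightarrow>
     card (pverts K) > l \<and>
     (\<forall>S \<subseteq> pverts K. card S < l \<longrightarrow>
        Digraph_Component.connected (with_proj K \<restriction> (pverts K - S)))"

end

theory Submission
  imports Defs
begin

text \<open>Put \<open>c = 1 / (2 * \<sigma>) \<le> \<sigma>\<close>. If a separation splits \<open>G\<close> into \<open>A\<close> and \<open>B\<close> of normalized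
  sizes \<open>1 + a\<close> and \<open>1 + b\<close> with \<open>b \<le> a\<close>, then \<open>g = a + b\<close>, and since the arcs of \<open>B\<close> outside \<open>A\<close>
  avoid the square on the separator, \<open>B\<close> contributes at most \<open>(1 + b)\<^sup>2 - 1 = (2 + b) * b\<close> to the
  arcs beyond those of \<open>A\<close>. Splitting always the larger side, one obtains
  \<open>1 + 2 * g + \<sigma>\<^sup>2 + (g - \<sigma>)\<^sup>2\<close> as an upper bound in the range \<open>\<sigma> < g \<le> 2 * \<sigma>\<close>. This starts
  an induction for \<open>g \<ge> \<sigma> + c\<close>: a part with \<open>b \<le> \<sigma> + c\<close> costs at most \<open>(2 + \<sigma> + c) * b\<close>, and if
  both parts are smaller than \<open>\<sigma> + c\<close> the quadratic bound for \<open>A\<close> suffices.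

  For a simple graph \<open>H\<close>, adding all loops turns the average degree \<open>d\<close> into \<open>d + 1\<close> arcs per
  vertex, which is too many for a \<open>\<sigma>\<close>-separable graph. The exception is \<open>k = 1\<close>, \<open>\<sigma> < 1\<close>:
  a single edge then is neither 2-connected nor separable, and one uses instead that a graph
  without 2-connected subgraphs on at least three vertices is a forest.\<close>

section \<open>Vertex sets, normalized arc counts and separators\<close>

definition excess :: "nat \<Rightarrow> 'a set \<Rightarrow> real" where
  "excess k W = real (card W) / real k - 1"

definition density :: "nat \<Rightarrow> 'a rel \<Rightarrow> 'a set \<Rightarrow> real" where
  "density k E W = real (card (E \<inter> W \<times> W)) / (real k)\<^sup>2"

text \<open>The parts of a separation are induced, so their vertex sets determine them. In this form
  \<open>E\<close> can gain loops without losing any split.\<close>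

definition splits :: "nat \<Rightarrow> 'a rel \<Rightarrow> 'a set \<Rightarrow> 'a set \<Rightarrow> 'a set \<Rightarrow> bool" where
  "splits k E W A B \<longleftrightarrow> A \<union> B = W \<and> A \<noteq> W \<and> B \<noteq> W \<and> card (A \<inter> B) = k \<and>
     E \<inter> W \<times> W \<subseteq> A \<times> A \<union> B \<times> B"

lemma splits_commute: "splits k E W A B \<longleftrightarrow> splits k E W B A"
  by (auto simp: splits_def Int_commute)

lemma splits_psubset:
  assumes "splits k E W A B"
  shows "A \<subset> W" "B \<subset> W"
  using assms by (auto simp: splits_def)

lemma density_le_square:
  assumes "finite W" "k > 0"
  shows "density k E W \<le> (1 + excess k W)\<^sup>2"
proof -
  have "card (E \<inter> W \<times> W) \<le> card (W \<times> W)"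
    using assms by (intro card_mono) auto
  then have "real (card (E \<inter> W \<times> W)) \<le> (real (card W))\<^sup>2"
    by (simp add: card_cartesian_product power2_eq_square flip: of_nat_mult)
  then show ?thesis
    by (simp add: density_def excess_def power_divide divide_right_mono)
qed

lemma splits_card:
  assumes "finite W" "splits k E W A B"
  shows "card A + card B = card W + k" "k < card A" "k < card B"
proof -
  have fin: "finite A" "finite B"
    using splits_psubset[OF assms(2)] assms(1) by (meson finite_subset psubset_imp_subset)+
  show "card A + card B = card W + k"
    using card_Un_Int[OF fin] assms(2) by (auto simp: splits_def)
  moreover have "card A < card W" "card B < card W"
    using splits_psubset[OF assms(2)] assms(1) by (auto intro: psubset_card_mono)
  ultimately show "k < card A" "k < card B" by auto
qed

lemma splits_excess:
  assumes "finite W" "k > 0" "splits k E W A B"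
  shows "excess k A + excess k B = excess k W" "0 < excess k A" "0 < excess k B"
proof -
  have "real (card A) + real (card B) = real (card W) + real k"
    using splits_card(1)[OF assms(1,3)] by (metis of_nat_add)
  then have "(real (card A) + real (card B)) / real k = real (card W) / real k + 1"
    using \<open>k > 0\<close> by (simp add: add_divide_distrib)
  then show "excess k A + excess k B = excess k W"
    by (simp add: excess_def add_divide_distrib)
  show "0 < excess k A" "0 < excess k B"
    using splits_card(2,3)[OF assms(1,3)] \<open>k > 0\<close> by (auto simp: excess_def field_simps)
qed

text \<open>The first bound serves when both parts are handled by induction, the second when the
  crude square bound on \<open>B\<close> is good enough.\<close>

lemma splits_density:
  assumes "finite W" "k > 0" "splits k E W A B"
  shows "density k E W \<le> density k E A + density k E B"
    and "density k E W \<le> density k E A + 2 * excess k B + (excess k B)\<^sup>2"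
proof -
  have fin: "finite A" "finite B"
    using splits_psubset[OF assms(3)] assms(1) by (meson finite_subset psubset_imp_subset)+
  have cover: "E \<inter> W \<times> W \<subseteq> (E \<inter> A \<times> A) \<union> (E \<inter> B \<times> B)"
    using assms(3) by (auto simp: splits_def)
  have "card (E \<inter> W \<times> W) \<le> card (E \<inter> A \<times> A) + card (E \<inter> B \<times> B)"
    using card_mono[OF _ cover] card_Un_le[of "E \<inter> A \<times> A" "E \<inter> B \<times> B"] fin by fastforce
  then have "real (card (E \<inter> W \<times> W)) \<le> real (card (E \<inter> A \<times> A)) + real (card (E \<inter> B \<times> B))"
    by linarith
  then show "density k E W \<le> density k E A + density k E B"
    by (simp add: density_def divide_right_mono flip: add_divide_distrib)
  let ?S = "A \<inter> B"
  have "E \<inter> W \<times> W \<subseteq> (E \<inter> A \<times> A) \<union> (B \<times> B - ?S \<times> ?S)"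
    using cover by auto
  then have "card (E \<inter> W \<times> W) \<le> card ((E \<inter> A \<times> A) \<union> (B \<times> B - ?S \<times> ?S))"
    using fin by (intro card_mono) auto
  also have "\<dots> \<le> card (E \<inter> A \<times> A) + card (B \<times> B - ?S \<times> ?S)"
    by (rule card_Un_le)
  also have "card (B \<times> B - ?S \<times> ?S) = card (B \<times> B) - card (?S \<times> ?S)"
    using fin by (intro card_Diff_subset) auto
  also have "\<dots> = (card B)\<^sup>2 - k\<^sup>2"
    using assms(3) by (simp add: splits_def card_cartesian_product power2_eq_square)
  \<comment> \<open>The subtraction on naturals is exact because \<open>k < card B\<close>.\<close>
  finally have "card (E \<inter> W \<times> W) + k\<^sup>2 \<le> card (E \<inter> A \<times> A) + (card B)\<^sup>2"
    using splits_card(3)[OF assms(1,3)]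
    by (metis add.assoc add_le_cancel_right le_add_diff_inverse2 less_imp_le power_mono zero_le)
  then have "real (card (E \<inter> W \<times> W)) + (real k)\<^sup>2 \<le> real (card (E \<inter> A \<times> A)) + (real (card B))\<^sup>2"
    by (metis of_nat_add of_nat_le_iff of_nat_power)
  then have "(real (card (E \<inter> W \<times> W)) + (real k)\<^sup>2) / (real k)\<^sup>2
      \<le> (real (card (E \<inter> A \<times> A)) + (real (card B))\<^sup>2) / (real k)\<^sup>2"
    by (intro divide_right_mono) auto
  then have "density k E W + 1 \<le> density k E A + (real (card B) / real k)\<^sup>2"
    using \<open>k > 0\<close> by (simp add: density_def add_divide_distrib power_divide)
  also have "(real (card B) / real k)\<^sup>2 = 1 + 2 * excess k B + (excess k B)\<^sup>2"
    by (simp add: excess_def power2_eq_square algebra_simps)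
  finally show "density k E W \<le> density k E A + 2 * excess k B + (excess k B)\<^sup>2"
    by simp
qed

section \<open>Extremal sums of squares\<close>

text \<open>The greatest sum of squares of nonnegative numbers that are at most \<open>\<sigma>\<close> and sum to
  \<open>g \<le> 2 * \<sigma>\<close>.\<close>

definition square_bound :: "real \<Rightarrow> real \<Rightarrow> real" where
  "square_bound \<sigma> g = (if g \<le> \<sigma> then g\<^sup>2 else \<sigma>\<^sup>2 + (g - \<sigma>)\<^sup>2)"

text \<open>Concentrating a fixed sum increases the squares: the gain is
  \<open>2 * (\<sigma> - a) * (\<sigma> - b)\<close> if \<open>a \<le> \<sigma>\<close>, and
  \<open>2 * (a - \<sigma>) * b\<close> otherwise.\<close>

lemma square_bound_add:
  assumes "0 < b" "b \<le> \<sigma>" "0 < a" "\<sigma> < a + b"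
  shows "square_bound \<sigma> a + b\<^sup>2 \<le> square_bound \<sigma> (a + b)"
proof (cases "a \<le> \<sigma>")
  case True
  have "0 \<le> (\<sigma> - a) * (\<sigma> - b)"
    using True assms by simp
  then show ?thesis
    using True assms by (simp add: square_bound_def power2_eq_square algebra_simps)
next
  case False
  then have "0 \<le> (a - \<sigma>) * b"
    using assms by simp
  then show ?thesis
    using False assms by (simp add: square_bound_def power2_eq_square algebra_simps)
qed

text \<open>Put \<open>f x = x * (\<sigma> + c - x)\<close>. The claim is that \<open>f\<close> sums
  to at least 1 over the pieces \<open>a\<close> and \<open>b\<close>, where an
  \<open>a > \<sigma>\<close> is cut into \<open>\<sigma>\<close> and \<open>a - \<sigma>\<close>.
  As \<open>\<sigma> * c = 1 / 2\<close>, the concave \<open>f\<close> is at least 1/2 on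
  \<open>[c, \<sigma>]\<close>, with equality at the ends. So a piece \<open>\<sigma>\<close> gives
  1/2, and the others must supply another half.\<close>

lemma square_bound_sum_le:
  assumes "c \<le> \<sigma>" "0 < c" "\<sigma> * c = 1 / 2"
    and "0 < b" "b \<le> a" "a < \<sigma> + c" "\<sigma> + c \<le> a + b"
  shows "1 + square_bound \<sigma> a + b\<^sup>2 \<le> (\<sigma> + c) * (a + b)"
proof -
  have mid: "1 / 2 \<le> x * (\<sigma> + c - x)" if "c \<le> x" "x \<le> \<sigma>" for x
  proof -
    have "0 \<le> (x - c) * (\<sigma> - x)" using that by simp
    then show ?thesis using assms(3) by (simp add: algebra_simps)
  qed
  consider "a \<le> \<sigma>" | "\<sigma> < a" "c \<le> b" "b \<le> \<sigma>" | "\<sigma> < a" "b < c" | "\<sigma> < a" "\<sigma> < b"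
    by linarith
  then show ?thesis
  proof cases
    case 1
    then have "1 / 2 \<le> a * (\<sigma> + c - a)" "1 / 2 \<le> b * (\<sigma> + c - b)"
      using assms by (intro mid; linarith)+
    with 1 show ?thesis
      by (simp add: square_bound_def power2_eq_square algebra_simps)
  next
    case 2
    have "0 \<le> (a - \<sigma>) * (\<sigma> + c - (a - \<sigma>))"
      using 2 assms by simp
    moreover have "1 / 2 \<le> b * (\<sigma> + c - b)"
      using 2 by (intro mid)
    ultimately show ?thesis
      using 2 assms(3) by (simp add: square_bound_def power2_eq_square algebra_simps)
  next
    case 3
    \<comment> \<open>Both \<open>a - \<sigma>\<close> and \<open>b\<close> are below
      \<open>c\<close>, so the last factors exceed \<open>\<sigma>\<close>. The two pieces sum to at
      least \<open>c\<close>, which yields the missing 1/2.\<close>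
    have "(a - \<sigma>) * \<sigma> \<le> (a - \<sigma>) * (\<sigma> + c - (a - \<sigma>))" "b * \<sigma> \<le> b * (\<sigma> + c - b)"
      using 3 assms by (auto intro!: mult_left_mono)
    moreover have "c * \<sigma> \<le> (a - \<sigma> + b) * \<sigma>"
      using assms by (intro mult_right_mono) auto
    ultimately show ?thesis
      using 3 assms(3) by (simp add: square_bound_def power2_eq_square algebra_simps)
  next
    case 4
    \<comment> \<open>The left side is the amount by which \<open>b * (\<sigma> + c - b)\<close>
      falls short of 1/2. The piece \<open>a - \<sigma>\<close> makes up for it, since
      \<open>b \<le> a\<close> and both exceed \<open>\<sigma>\<close> by less than
      \<open>c\<close>.\<close>
    have "(b - \<sigma>) * (\<sigma> - c + (b - \<sigma>)) \<le> (a - \<sigma>) * (\<sigma> + c - (a - \<sigma>))"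
      using 4 assms by (intro mult_mono) auto
    then show ?thesis
      using 4 assms(3) by (simp add: square_bound_def power2_eq_square algebra_simps)
  qed
qed

section \<open>Density bounds by induction on the vertex set\<close>

context
  fixes k :: nat and \<sigma> :: real and E :: "'a rel" and V :: "'a set"
  assumes k_pos: "k > 0" and finite_V: "finite V"
    and split_ex: "\<And>W. W \<subseteq> V \<Longrightarrow> \<sigma> < excess k W \<Longrightarrow> \<exists>A B. splits k E W A B"
begin

lemma split_smaller_right:
  assumes "W \<subseteq> V" "\<sigma> < excess k W"
  obtains A B where "splits k E W A B" "excess k B \<le> excess k A" "card A < card W" "card B < card W"
    "A \<subseteq> V" "B \<subseteq> V"
proof -
  obtain A' B' where "splits k E W A' B'"
    using split_ex assms by blast
  then obtain A B where AB: "splits k E W A B" "excess k B \<le> excess k A"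
    by (metis linear splits_commute)
  moreover have "finite W"
    using assms(1) finite_V by (rule finite_subset)
  ultimately show ?thesis
    using that splits_psubset[OF AB(1)] assms(1) by (meson psubset_card_mono psubset_imp_subset subset_trans)
qed

text \<open>Up to \<open>\<sigma>\<close> this is the trivial square bound. Beyond, the smaller part
  has excess at most \<open>\<sigma>\<close>, as the two sum to at most \<open>2 * \<sigma>\<close>,
  so \<open>square_bound_add\<close> absorbs its square.\<close>

lemma density_le_square_bound:
  assumes "W \<subseteq> V" "excess k W \<le> 2 * \<sigma>"
  shows "density k E W \<le> 1 + 2 * excess k W + square_bound \<sigma> (excess k W)"
  using assms
proof (induction "card W" arbitrary: W rule: less_induct)
  case less
  have fin: "finite W"
    using less.prems(1) finite_V by (rule finite_subset)
  show ?case
  proof (cases "excess k W \<le> \<sigma>")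
    case True
    then show ?thesis
      using density_le_square[OF fin k_pos, of E]
      by (simp add: square_bound_def power2_eq_square algebra_simps)
  next
    case False
    then obtain A B where AB: "splits k E W A B" "excess k B \<le> excess k A" "card A < card W" "A \<subseteq> V"
      using split_smaller_right[OF less.prems(1)] by (metis not_le)
    note sum = splits_excess[OF fin k_pos AB(1)]
    have "density k E A \<le> 1 + 2 * excess k A + square_bound \<sigma> (excess k A)"
      using AB sum less.prems by (intro less.hyps) auto
    moreover have "square_bound \<sigma> (excess k A) + (excess k B)\<^sup>2 \<le> square_bound \<sigma> (excess k A + excess k B)"
      using AB sum less.prems False by (intro square_bound_add) auto
    ultimately show ?thesis
      using splits_density(2)[OF fin k_pos AB(1)] sum(1) by simp
  qed
qed

text \<open>The linear bound can fail for small sets: at excess 0 the density may be 1. The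
  induction hypothesis covers only parts of excess at least \<open>\<sigma> + c\<close>, hence three
  cases.\<close>

lemma density_le_linear:
  assumes c: "c \<le> \<sigma>" "0 < c" "\<sigma> * c = 1 / 2"
    and "W \<subseteq> V" "\<sigma> + c \<le> excess k W"
  shows "density k E W \<le> (2 + \<sigma> + c) * excess k W"
  using assms(4,5)
proof (induction "card W" arbitrary: W rule: less_induct)
  case less
  have fin: "finite W"
    using less.prems(1) finite_V by (rule finite_subset)
  have "\<sigma> < excess k W"
    using less.prems(2) c by simp
  then obtain A B where AB: "splits k E W A B" "excess k B \<le> excess k A" "card A < card W"
      "card B < card W" "A \<subseteq> V" "B \<subseteq> V"
    using split_smaller_right[OF less.prems(1)] by metis
  let ?a = "excess k A" and ?b = "excess k B"
  note sum = splits_excess[OF fin k_pos AB(1)]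
  note dens = splits_density[OF fin k_pos AB(1)]
  consider "\<sigma> + c \<le> ?b" | "?b < \<sigma> + c" "\<sigma> + c \<le> ?a" | "?a < \<sigma> + c"
    by linarith
  then show ?case
  proof cases
    case 1
    then have "density k E A \<le> (2 + \<sigma> + c) * ?a" "density k E B \<le> (2 + \<sigma> + c) * ?b"
      using AB by (auto intro!: less.hyps)
    then show ?thesis
      using dens(1) by (simp add: sum(1)[symmetric] distrib_left)
  next
    case 2
    then have "density k E A \<le> (2 + \<sigma> + c) * ?a"
      using AB by (intro less.hyps)
    moreover have "?b * ?b \<le> (\<sigma> + c) * ?b"
      using 2 sum by (intro mult_right_mono) auto
    ultimately show ?thesis
      using dens(2) by (simp add: sum(1)[symmetric] algebra_simps power2_eq_square)
  next
    case 3
    \<comment> \<open>By \<open>c \<le> \<sigma>\<close>, \<open>?a\<close> is below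
      \<open>2 * \<sigma>\<close>, the range of the quadratic bound.\<close>
    have "density k E A \<le> 1 + 2 * ?a + square_bound \<sigma> ?a"
      using 3 c AB by (intro density_le_square_bound) auto
    moreover have "1 + square_bound \<sigma> ?a + ?b\<^sup>2 \<le> (\<sigma> + c) * (?a + ?b)"
      using 3 sum AB less.prems by (intro square_bound_sum_le c) auto
    ultimately show ?thesis
      using dens(2) by (simp add: sum(1)[symmetric] algebra_simps)
  qed
qed

end

section \<open>From separability and connectivity to splits of vertex sets\<close>

lemma separable_imp_splits:
  assumes "pair_fin_digraph G" "separable k \<sigma> G" "k > 0" "W \<subseteq> pverts G" "\<sigma> < excess k W"
  shows "\<exists>A B. splits k (parcs G) W A B"
proof -
  interpret pair_fin_digraph G by fact
  \<comment> \<open>The induced subgraph has all arcs inside \<open>W\<close>, so its separation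
    covers all of them.\<close>
  define C where "C = \<lparr>pverts = W, parcs = parcs G \<inter> W \<times> W\<rparr>"
  have "wf_digraph (with_proj C)"
    by unfold_locales (auto simp: C_def)
  then have "subgraph (with_proj C) (with_proj G)"
    using assms(4) wf_digraph_axioms by (auto simp: C_def intro!: subgraphI)
  moreover have "vbar k C > 1 + \<sigma>"
    using assms(5) by (simp add: vbar_def excess_def C_def)
  ultimately obtain A B where AB: "separation k C A B"
    using assms(2) unfolding separable_def by blast
  have wf: "pair_wf_digraph A" "pair_wf_digraph B"
    using AB by (auto simp: separation_def induced_subgraph_def subgraph_def wf_digraph_wp_iff)
  have "parcs A \<subseteq> pverts A \<times> pverts A" "parcs B \<subseteq> pverts B \<times> pverts B"
    using pair_wf_digraph.wellformed'[OF wf(1)] pair_wf_digraph.wellformed'[OF wf(2)] by auto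
  moreover have "parcs G \<inter> W \<times> W = parcs A \<union> parcs B"
    using AB by (simp add: separation_def C_def)
  moreover have "pverts A \<noteq> W" "pverts B \<noteq> W"
    using AB by (auto simp: separation_def induced_subgraph_def spanning_def C_def)
  moreover have "pverts A \<union> pverts B = W" "card (pverts A \<inter> pverts B) = k"
    using AB by (simp_all add: separation_def C_def)
  ultimately have "splits k (parcs G) W (pverts A) (pverts B)"
    unfolding splits_def by blast
  then show ?thesis by blast
qed

text \<open>Every edge is the image of at least two arcs: an arc and its reverse, distinct for lack
  of loops.\<close>

lemma card_undirected_edges:
  assumes "pair_graph H"
  shows "2 * card (undirected_edges H) \<le> card (parcs H)"
proof -
  interpret pair_graph H by fact
  let ?f = "\<lambda>(u, v). {u, v}"
  have two: "2 \<le> card {p \<in> parcs H. ?f p = e}" if "e \<in> undirected_edges H" for e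
  proof -
    obtain u v where uv: "(u, v) \<in> parcs H" "e = {u, v}"
      using \<open>e \<in> undirected_edges H\<close> by (auto simp: undirected_edges_def)
    then have "{(u, v), (v, u)} \<subseteq> {p \<in> parcs H. ?f p = e}"
      using arcs_symmetric by auto
    then have "card {(u, v), (v, u)} \<le> card {p \<in> parcs H. ?f p = e}"
      using pair_finite_arcs by (intro card_mono) auto
    then show ?thesis
      using no_loops'[OF uv(1)] by simp
  qed
  have "2 * card (undirected_edges H) = (\<Sum>e\<in>undirected_edges H. 2)"
    by simp
  also have "\<dots> \<le> (\<Sum>e\<in>undirected_edges H. card {p \<in> parcs H. ?f p = e})"
    by (intro sum_mono two)
  also have "\<dots> = card (parcs H)"
    using sum.image_gen[OF pair_finite_arcs, of "\<lambda>_. 1::nat" ?f] by (simp add: undirected_edges_def)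
  finally show ?thesis .
qed

text \<open>One side is the set reachable from some \<open>u\<close> in the symmetric closure,
  through which connectedness is defined. An arc across, in either direction, would enlarge
  it.\<close>

lemma disconnected_partition:
  assumes "pair_wf_digraph H" "symmetric (with_proj H)" "U \<noteq> {}"
    and "\<not> Digraph_Component.connected (with_proj H \<restriction> U)"
  obtains X Y where "X \<union> Y = U" "X \<inter> Y = {}" "X \<noteq> {}" "Y \<noteq> {}" "parcs H \<inter> X \<times> Y = {}" "parcs H \<inter> Y \<times> X = {}"
proof -
  let ?M = "mk_symmetric (with_proj H \<restriction> U)"
  interpret wf_digraph "with_proj H \<restriction> U"
    using assms(1) by (simp flip: wf_digraph_wp_iff add: wf_digraph.wellformed_induce_subgraph)
  interpret M: pair_wf_digraph ?M ..
  \<comment> \<open>The empty graph is not connected by definition; \<open>U \<noteq> {}\<close>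
    rules that case out.\<close>
  obtain u v where uv: "u \<in> U" "v \<in> U" "\<not> u \<rightarrow>\<^sup>*\<^bsub>with_proj ?M\<^esub> v"
    using assms(3,4) by (auto simp: connected_def strongly_connected_def)
  define X where "X = {x \<in> U. u \<rightarrow>\<^sup>*\<^bsub>with_proj ?M\<^esub> x}"
  have closed: "y \<in> X" if "x \<in> X" "y \<in> U" "(x, y) \<in> parcs H \<or> (y, x) \<in> parcs H" for x y
  proof -
    have "(x, y) \<in> parcs ?M"
      using that by (auto simp: parcs_mk_symmetric X_def)
    then show ?thesis
      using that M.reachable_adj_trans[of u x y] by (simp add: X_def)
  qed
  show ?thesis
  proof
    show "X \<union> (U - X) = U" "X \<inter> (U - X) = {}" by (auto simp: X_def)
    show "X \<noteq> {}" using uv(1) M.reachable_refl[of u] by (auto simp: X_def)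
    show "U - X \<noteq> {}" using uv by (auto simp: X_def)
    show "parcs H \<inter> X \<times> (U - X) = {}" "parcs H \<inter> (U - X) \<times> X = {}"
      using closed by auto
  qed
qed

text \<open>A disconnecting set \<open>S\<close> may have fewer than \<open>k\<close> vertices, a
  separator has exactly \<open>k\<close>. \<open>S\<close> is padded by a set \<open>T\<close> that
  avoids one vertex on each side, which keeps both parts proper.\<close>

lemma not_l_connected_imp_splits:
  assumes "pair_graph H" "pverts H = W" "k + 1 < card W" "\<not> l_connected (k + 1) H"
  shows "\<exists>A B. splits k (parcs H) W A B"
proof -
  interpret pair_graph H by fact
  have fin: "finite W"
    using pair_finite_verts assms(2) by simp
  obtain S where S: "S \<subseteq> W" "card S \<le> k" "\<not> Digraph_Component.connected (with_proj H \<restriction> (W - S))"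
    using assms(2-4) by (auto simp: l_connected_def less_Suc_eq_le)
  have "W - S \<noteq> {}"
    using S assms(3) fin by (metis Diff_eq_empty_iff card_mono finite_subset le_add1 le_trans not_le)
  then obtain X Y where XY: "X \<union> Y = W - S" "X \<inter> Y = {}" "X \<noteq> {}" "Y \<noteq> {}"
      "parcs H \<inter> X \<times> Y = {}" "parcs H \<inter> Y \<times> X = {}"
    using disconnected_partition[OF pair_wf_digraph_axioms pair_sym_arcs _ S(3)] by blast
  obtain x y where xy: "x \<in> X" "y \<in> Y" using XY by auto
  have finS: "finite S" using S(1) fin by (rule finite_subset)
  have "x \<noteq> y" "{x, y} \<subseteq> W - S" using xy XY by auto
  then have "card (W - S - {x, y}) = card W - card S - 2"
    using finS S(1) by (simp add: card_Diff_subset del: Diff_insert)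
  \<comment> \<open>At least \<open>k + 2\<close> vertices are present, so enough remain once
    \<open>x\<close> and \<open>y\<close> are reserved.\<close>
  then have "k - card S \<le> card (W - S - {x, y})"
    using assms(3) by simp
  then obtain T where T: "T \<subseteq> W - S - {x, y}" "card T = k - card S" "finite T"
    by (rule obtain_subset_with_card_n)
  have "card (S \<union> T) = card S + card T"
    using finS T by (intro card_Un_disjoint) auto
  then have "card (S \<union> T) = k" using S(2) T(2) by simp
  moreover have "(X \<union> (S \<union> T)) \<inter> (Y \<union> (S \<union> T)) = S \<union> T"
    using XY(2) by auto
  moreover have "X \<union> (S \<union> T) \<union> (Y \<union> (S \<union> T)) = W"
    using XY(1) S(1) T(1) by auto
  moreover have "x \<in> W" "y \<in> W" "x \<notin> Y \<union> (S \<union> T)" "y \<notin> X \<union> (S \<union> T)"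
    using xy XY(1,2) T(1) by auto
  moreover have "parcs H \<inter> W \<times> W \<subseteq> (X \<union> (S \<union> T)) \<times> (X \<union> (S \<union> T)) \<union> (Y \<union> (S \<union> T)) \<times> (Y \<union> (S \<union> T))"
    using XY(1,5,6) by auto
  ultimately have "splits k (parcs H) W (X \<union> (S \<union> T)) (Y \<union> (S \<union> T))"
    unfolding splits_def by metis
  then show ?thesis by blast
qed

lemma induced_not_l_connected_imp_splits:
  assumes "pair_graph H" "W \<subseteq> pverts H" "k + 1 < card W"
    and no_K: "\<And>K. pair_graph K \<Longrightarrow> subgraph (with_proj K) (with_proj H) \<Longrightarrow> pverts K = W \<Longrightarrow>
      \<not> l_connected (k + 1) K"
  shows "\<exists>A B. splits k (parcs H) W A B"
proof -
  interpret pair_graph H by fact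
  define K where "K = \<lparr>pverts = W, parcs = parcs H \<inter> W \<times> W\<rparr>"
  have "finite W" using assms(2) pair_finite_verts by (rule finite_subset)
  then have "pair_graph K"
    using pair_finite_arcs no_loops' arcs_symmetric
    by unfold_locales (auto simp: K_def symmetric_def intro!: symI)
  moreover from this have "subgraph (with_proj K) (with_proj H)"
    using assms(2) wf_digraph_axioms by (auto simp: K_def wf_digraph_wp_iff pair_graph_def pair_digraph_def pair_fin_digraph_def intro!: subgraphI)
  moreover have "pverts K = W" by (simp add: K_def)
  ultimately obtain A B where "splits k (parcs K) W A B"
    using not_l_connected_imp_splits[of K W k] no_K assms(3) by blast
  then have "splits k (parcs H) W A B"
    by (simp add: splits_def K_def inf_assoc)
  then show ?thesis by blast
qed

section \<open>Simple graphs with many edges\<close>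

text \<open>This is the forest bound of \<open>card W - 1\<close> edges, counted in arcs and without
  subtraction. Since \<open>card A + card B = card W + 1\<close>, the bounds for the two parts add
  up exactly.\<close>

lemma card_nonloops_le:
  assumes "finite V" "W \<subseteq> V" "W \<noteq> {}"
    and split_ex: "\<And>W. W \<subseteq> V \<Longrightarrow> 2 < card W \<Longrightarrow> \<exists>A B. splits 1 E W A B"
  shows "card (E \<inter> W \<times> W - Id) + 2 \<le> 2 * card W"
  using assms(2,3)
proof (induction "card W" arbitrary: W rule: less_induct)
  case less
  have fin: "finite W"
    using less.prems(1) \<open>finite V\<close> by (rule finite_subset)
  show ?case
  proof (cases "2 < card W")
    case True
    then obtain A B where AB: "splits 1 E W A B"
      using split_ex less.prems(1) by blast
    note ss = splits_psubset[OF AB]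
    have finAB: "finite A" "finite B"
      using ss fin by (meson finite_subset psubset_imp_subset)+
    have ne: "A \<noteq> {}" "B \<noteq> {}"
      using AB by (auto simp: splits_def)
    have "card (E \<inter> A \<times> A - Id) + 2 \<le> 2 * card A" "card (E \<inter> B \<times> B - Id) + 2 \<le> 2 * card B"
      using ss fin ne less.prems(1) by (intro less.hyps psubset_card_mono; blast)+
    moreover have "card (E \<inter> W \<times> W - Id) \<le> card ((E \<inter> A \<times> A - Id) \<union> (E \<inter> B \<times> B - Id))"
      using AB finAB by (intro card_mono) (auto simp: splits_def)
    moreover have "\<dots> \<le> card (E \<inter> A \<times> A - Id) + card (E \<inter> B \<times> B - Id)"
      by (rule card_Un_le)
    ultimately show ?thesis
      using splits_card(1)[OF fin AB] by linarith
  next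
    case False
    have "card (E \<inter> W \<times> W - Id) \<le> card (W \<times> W - Id_on W)"
      using fin by (intro card_mono) (auto simp: Id_on_iff)
    also have "\<dots> = card (W \<times> W) - card (Id_on W)"
      using fin by (intro card_Diff_subset) (auto simp: Id_on_def)
    also have "card (Id_on W) = card W"
      by (simp add: Id_on_def UNION_singleton_eq_range card_image inj_on_def)
    finally have "card (E \<inter> W \<times> W - Id) \<le> card W * card W - card W"
      by (simp add: card_cartesian_product)
    \<comment> \<open>At \<open>n = 1\<close> and \<open>n = 2\<close>, \<open>n * n - n\<close>
      equals \<open>2 * n - 2\<close>.\<close>
    moreover have "card W = 1 \<or> card W = 2"
      using False less.prems(2) fin card_gt_0_iff[of W] by auto
    ultimately show ?thesis by auto
  qed
qed

text \<open>One loop per vertex makes up for the \<open>- 1\<close>. The arcs then number at least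
  \<open>(2 + \<sigma> + c) * k\<close> per vertex, while the normalized linear bound is lower by
  \<open>2 + \<sigma> + c\<close>.\<close>

lemma many_edges_imp_not_splits:
  assumes "k > 0" and c: "c \<le> \<sigma>" "0 < c" "\<sigma> * c = 1 / 2"
    and "pair_graph H" "pverts H \<noteq> {}"
    and edges: "((2 + \<sigma> + c) * real k - 1) * real (card (pverts H)) \<le> real (card (parcs H))"
  shows "\<exists>W \<subseteq> pverts H. \<sigma> < excess k W \<and> k + 1 < card W \<and> \<not> (\<exists>A B. splits k (parcs H) W A B)"
proof (rule ccontr)
  assume "\<not> ?thesis"
  then have split_ex: "\<exists>A B. splits k (parcs H) W A B"
    if "W \<subseteq> pverts H" "\<sigma> < excess k W" "k + 1 < card W" for W
    using that by blast
  interpret pair_graph H by fact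
  let ?n = "card (pverts H)"
  have sub: "parcs H \<subseteq> pverts H \<times> pverts H"
    using wellformed' by auto
  have n_pos: "?n > 0"
    using assms(6) pair_finite_verts by (simp add: card_gt_0_iff)
  have sum_ge: "1 \<le> \<sigma> + c"
  proof -
    have "0 \<le> (\<sigma> - c)\<^sup>2" by simp
    then have "1\<^sup>2 \<le> (\<sigma> + c)\<^sup>2"
      using c(3) by (simp add: power2_eq_square algebra_simps)
    then show ?thesis
      by (rule power2_le_imp_le) (use c(1,2) in auto)
  qed
  show False
  \<comment> \<open>If \<open>\<sigma> * k \<ge> 1\<close>, an excess above \<open>\<sigma>\<close>
    already forces more than \<open>k + 1\<close> vertices.\<close>
  proof (cases "1 \<le> \<sigma> * real k")
    case True
    define E where "E = parcs H \<union> Id_on (pverts H)"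
    have "card (Id_on (pverts H)) = ?n"
      by (simp add: Id_on_def UNION_singleton_eq_range card_image inj_on_def)
    moreover have "finite (Id_on (pverts H))"
      using pair_finite_verts by (simp add: Id_on_def)
    moreover have "parcs H \<inter> Id_on (pverts H) = {}"
      using no_loops' by auto
    ultimately have card_E: "card E = card (parcs H) + ?n"
      unfolding E_def using pair_finite_arcs by (simp add: card_Un_disjoint)
    \<comment> \<open>Room for so many arcs requires many vertices, which puts the whole graph in
      the range of the linear bound.\<close>
    have "card E \<le> card (pverts H \<times> pverts H)"
      using sub pair_finite_verts by (intro card_mono) (auto simp: E_def)
    then have "real (card E) \<le> real ?n * real ?n"
      by (simp add: card_cartesian_product flip: of_nat_mult)
    moreover have E_ge: "(2 + \<sigma> + c) * real k * real ?n \<le> real (card E)"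
      using edges card_E by (simp add: algebra_simps)
    ultimately have "(2 + \<sigma> + c) * real k * real ?n \<le> real ?n * real ?n"
      by linarith
    then have "(2 + \<sigma> + c) * real k \<le> real ?n"
      using n_pos by simp
    then have ex: "\<sigma> + c \<le> excess k (pverts H)"
      using \<open>k > 0\<close> by (simp add: excess_def field_simps)
    have "\<exists>A B. splits k E W A B" if W: "W \<subseteq> pverts H" "\<sigma> < excess k W" for W
    proof -
      have "(1 + \<sigma>) * real k < real (card W)"
        using W(2) \<open>k > 0\<close> by (simp add: excess_def field_simps)
      then have "k + 1 < card W"
        using True by (simp add: algebra_simps)
      with split_ex W obtain A B where "splits k (parcs H) W A B" by blast
      then have "splits k E W A B"
        by (auto simp: splits_def E_def)
      then show ?thesis by blast
    qed
    then have "density k E (pverts H) \<le> (2 + \<sigma> + c) * excess k (pverts H)"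
      using \<open>k > 0\<close> pair_finite_verts ex by (intro density_le_linear[where V = "pverts H"] c) auto
    moreover have "E \<inter> pverts H \<times> pverts H = E"
      using sub by (auto simp: E_def)
    ultimately have "real (card E) / (real k)\<^sup>2 \<le> (2 + \<sigma> + c) * (real ?n / real k - 1)"
      by (simp add: density_def excess_def)
    moreover have "(2 + \<sigma> + c) * (real ?n / real k) \<le> real (card E) / (real k)\<^sup>2"
      using divide_right_mono[OF E_ge, of "(real k)\<^sup>2"] \<open>k > 0\<close> by (simp add: power2_eq_square)
    ultimately show False
      using c by (simp add: algebra_simps)
  next
    case False
    \<comment> \<open>From \<open>\<sigma> > 1 / 2\<close>, any \<open>k \<ge> 2\<close> would give
      \<open>\<sigma> * k \<ge> 1\<close>. With \<open>k = 1\<close> and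
      \<open>\<sigma> < 1\<close>, every set of more than two vertices splits.\<close>
    have "1 / 2 \<le> \<sigma> * \<sigma>"
      using mult_left_mono[OF c(1), of \<sigma>] c by simp
    then have "1 / 2 < \<sigma>"
      using mult_mono[of \<sigma> "1 / 2" \<sigma> "1 / 2"] c by (cases "\<sigma> \<le> 1 / 2") auto
    then have "k = 1"
      using False \<open>k > 0\<close> mult_mono[of "1/2" \<sigma> 2 "real k"] by (cases "k = 1") auto
    have "\<exists>A B. splits 1 (parcs H) W A B" if "W \<subseteq> pverts H" "2 < card W" for W
      using that split_ex[of W] False \<open>k = 1\<close> by (simp add: excess_def)
    then have "card (parcs H \<inter> pverts H \<times> pverts H - Id) + 2 \<le> 2 * ?n"
      using assms(6) pair_finite_verts by (intro card_nonloops_le[where V = "pverts H"]) auto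
    moreover have "parcs H \<inter> pverts H \<times> pverts H - Id = parcs H"
      using sub no_loops' by auto
    ultimately have "real (card (parcs H)) < 2 * real ?n"
      by simp
    \<comment> \<open>For \<open>k = 1\<close> the factor is \<open>1 + \<sigma> + c\<close>, and
      \<open>\<sigma> + c \<ge> 1\<close>.\<close>
    moreover have "2 * real ?n \<le> ((2 + \<sigma> + c) * real k - 1) * real ?n"
      using sum_ge \<open>k = 1\<close> by (intro mult_right_mono) auto
    ultimately show False
      using edges by linarith
  qed
qed

theorem theorem4:
  fixes k :: nat and \<sigma> \<delta> :: real
  assumes "k > 0"
    and "\<sigma> \<ge> 1 / sqrt 2"
    and "\<delta> = 2 + \<sigma> + 1 / (2 * \<sigma>)"
  shows "(\<forall>(G :: 'a pair_pre_digraph) g.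
            pair_fin_digraph G \<and> separable k \<sigma> G \<and>
            g = vbar k G - 1 \<and> g \<ge> \<sigma> + 1 / (2 * \<sigma>) \<longrightarrow>
              ebar k G \<le> \<delta> * g \<and> \<delta> * g < \<delta> * vbar k G) \<and>
         (\<forall>H :: 'b pair_pre_digraph.
            pair_graph H \<and> average_degree H \<ge> \<delta> * real k - 1 \<longrightarrow>
              (\<exists>K :: 'b pair_pre_digraph.
                 pair_graph K \<and> subgraph (with_proj K) (with_proj H) \<and>
                 l_connected (k + 1) K \<and> real (card (pverts K)) > (1 + \<sigma>) * real k))"
proof -
  define c where "c = 1 / (2 * \<sigma>)"
  have \<delta>: "\<delta> = 2 + \<sigma> + c" using assms(3) by (simp add: c_def)
  have "0 < 1 / sqrt (2::real)" by simp
  then have "0 < \<sigma>" using assms(2) by linarith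
  then have c: "0 < c" "\<sigma> * c = 1 / 2" by (auto simp: c_def)
  \<comment> \<open>The lower bound on \<open>\<sigma>\<close> amounts to
    \<open>2 * \<sigma>\<^sup>2 \<ge> 1\<close>, that is, \<open>c \<le> \<sigma>\<close>.\<close>
  have "(1 / sqrt 2)\<^sup>2 \<le> \<sigma>\<^sup>2"
    using assms(2) by (intro power_mono) auto
  then have "c \<le> \<sigma>"
    using \<open>0 < \<sigma>\<close> by (simp add: c_def field_simps power2_eq_square)
  have ebar_le: "ebar k G \<le> \<delta> * (vbar k G - 1)"
    if G: "pair_fin_digraph G" "separable k \<sigma> G" "\<sigma> + c \<le> vbar k G - 1"
    for G :: "'a pair_pre_digraph"
  proof -
    interpret pair_fin_digraph G by (rule G(1))
    have ex: "excess k (pverts G) = vbar k G - 1"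
      by (simp add: excess_def vbar_def)
    have "density k (parcs G) (pverts G) \<le> (2 + \<sigma> + c) * excess k (pverts G)"
      using \<open>k > 0\<close> pair_finite_verts G separable_imp_splits[OF G(1,2) \<open>k > 0\<close>] ex
      by (intro density_le_linear[where V = "pverts G"] c \<open>c \<le> \<sigma>\<close>) auto
    moreover have "parcs G \<inter> pverts G \<times> pverts G = parcs G"
      using wellformed' by auto
    ultimately show ?thesis
      by (simp add: \<delta> ex density_def ebar_def)
  qed
  have "0 < \<delta>"
    using c \<open>0 < \<sigma>\<close> by (simp add: \<delta>)
  have connected_ex: "\<exists>K. pair_graph K \<and> subgraph (with_proj K) (with_proj H) \<and>
      l_connected (k + 1) K \<and> real (card (pverts K)) > (1 + \<sigma>) * real k"
    if H: "pair_graph H" "\<delta> * real k - 1 \<le> average_degree H" for H :: "'b pair_pre_digraph"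
  proof -
    interpret pair_graph H by (rule H(1))
    \<comment> \<open>Division by zero gives the empty graph average degree 0. The threshold is at
      least 1, so \<open>H\<close> has a vertex.\<close>
    have "2 * 1 \<le> \<delta> * real k"
      using \<open>k > 0\<close> \<open>0 < \<sigma>\<close> c by (intro mult_mono) (auto simp: \<delta>)
    then have "average_degree H \<noteq> 0"
      using H(2) by linarith
    then have n: "card (pverts H) > 0"
      by (auto simp: average_degree_def intro: gr0I)
    then have "(\<delta> * real k - 1) * real (card (pverts H)) \<le> 2 * real (card (undirected_edges H))"
      using H(2) by (simp add: average_degree_def flip: pos_le_divide_eq)
    also have "\<dots> \<le> real (card (parcs H))"
      using card_undirected_edges[OF H(1)] by linarith
    finally obtain W where W: "W \<subseteq> pverts H" "\<sigma> < excess k W" "k + 1 < card W"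
        "\<not> (\<exists>A B. splits k (parcs H) W A B)"
      using many_edges_imp_not_splits[OF \<open>k > 0\<close> \<open>c \<le> \<sigma>\<close> c H(1)] n unfolding \<delta> by fastforce
    then obtain K where "pair_graph K" "subgraph (with_proj K) (with_proj H)" "pverts K = W"
        "l_connected (k + 1) K"
      using induced_not_l_connected_imp_splits[OF H(1) W(1,3)] by blast
    moreover have "(1 + \<sigma>) * real k < real (card W)"
      using W(2) \<open>k > 0\<close> by (simp add: excess_def field_simps)
    ultimately show ?thesis by blast
  qed
  show ?thesis
  proof (intro conjI allI impI)
    fix G :: "'a pair_pre_digraph" and g
    assume G: "pair_fin_digraph G \<and> separable k \<sigma> G \<and> g = vbar k G - 1 \<and> \<sigma> + 1 / (2 * \<sigma>) \<le> g"
    then show "ebar k G \<le> \<delta> * g"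
      using ebar_le[of G] unfolding c_def by blast
    show "\<delta> * g < \<delta> * vbar k G"
      using G \<open>0 < \<delta>\<close> by simp
  next
    fix H :: "'b pair_pre_digraph"
    assume "pair_graph H \<and> \<delta> * real k - 1 \<le> average_degree H"
    then show "\<exists>K. pair_graph K \<and> subgraph (with_proj K) (with_proj H) \<and>
        l_connected (k + 1) K \<and> (1 + \<sigma>) * real k < real (card (pverts K))"
      using connected_ex by blast
  qed
qed

end
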